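(* Let $n\geq 1$ and let $A,B\subseteq \mathbb{R}$ be finite sets with $|A|\geq 2$. Let $f\colon A^n\to B$ be any function. Then \[ s(f)\geq \sqrt{\frac{\deg(f)}{|A|-1}}, \] where $s(f)$ is the sensitivity of $f$ and $\deg(f)$ is the degree of $f$ (both defined below).
   Context: Let $m=|A|$. A polynomial $p\in\mathbb{R}[x_1,\dots,x_n]$ represents $f$ if $p(x)=f(x)$ for all $x\in A^n$. Every $f\colon A^n\to B$ is represented by a unique polynomial in which each variable appears with degree at most $m-1$; the degree $\deg(f)$ of $f$ is the total degree of this unique polynomial. Two points $x,y\in A^n$ are at Hamming distance $1$ if they differ in exactly one coordinate. The local sensitivity $s_x(f)$ of $f$ at $x\in A^n$ is the number of points $y\in A^n$ at Hamming distance $1$ from $x$ with $f(y)\neq f(x)$, and the sensitivity is $s(f)=\max_{x\in A^n} s_x(f)$. *)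

theory Defs
  imports Complex_Main "HOL-Library.FuncSet" "HOL-Library.Poly_Mapping"
begin

text \<open>
  The variables \<open>x\<^sub>1, \<dots>, x\<^sub>n\<close> are indexed by \<open>{..<n}\<close>. Points of \<open>A\<^sup>n\<close> are extensional
  functions on \<open>{..<n}\<close>, so that \<open>A\<^sup>n\<close> is a finite set and distinct points differ in some coordinate
  below \<open>n\<close>.
\<close>

definition cube :: "nat \<Rightarrow> real set \<Rightarrow> (nat \<Rightarrow> real) set" where
  "cube n A = ({..<n} \<rightarrow>\<^sub>E A)"

text \<open>
  Real polynomials in variables indexed by \<^typ>\<open>nat\<close>: finitely supported maps from monomials
  (finitely supported exponent functions) to coefficients, with the ring structure of
  \<^theory>\<open>HOL-Library.Poly_Mapping\<close>.
\<close>

type_synonym real_mpoly = "(nat \<Rightarrow>\<^sub>0 nat) \<Rightarrow>\<^sub>0 real"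

definition polys :: "nat \<Rightarrow> real_mpoly set" where
  "polys n = {p. \<forall>u \<in> Poly_Mapping.keys p. Poly_Mapping.keys u \<subseteq> {..<n}}"

definition eval_mpoly :: "real_mpoly \<Rightarrow> (nat \<Rightarrow> real) \<Rightarrow> real" where
  "eval_mpoly p x =
     (\<Sum>u \<in> Poly_Mapping.keys p. Poly_Mapping.lookup p u *
        (\<Prod>i \<in> Poly_Mapping.keys u. x i ^ Poly_Mapping.lookup u i))"

text \<open>The zero polynomial is given total degree \<open>0\<close>.\<close>

definition total_degree :: "real_mpoly \<Rightarrow> nat" where
  "total_degree p =
     Max (insert 0 ((\<lambda>u. \<Sum>i \<in> Poly_Mapping.keys u. Poly_Mapping.lookup u i) `
       Poly_Mapping.keys p))"

definition var_degrees_le :: "real_mpoly \<Rightarrow> nat \<Rightarrow> bool" where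
  "var_degrees_le p d \<longleftrightarrow> (\<forall>u \<in> Poly_Mapping.keys p. \<forall>i. Poly_Mapping.lookup u i \<le> d)"

definition represents :: "nat \<Rightarrow> real set \<Rightarrow> real_mpoly \<Rightarrow> ((nat \<Rightarrow> real) \<Rightarrow> real) \<Rightarrow> bool" where
  "represents n A p f \<longleftrightarrow> (\<forall>x \<in> cube n A. eval_mpoly p x = f x)"

text \<open>
  For finite nonempty \<open>A\<close> the described polynomial exists and is unique (Lagrange interpolation
  in each coordinate).
\<close>

definition representing_poly :: "nat \<Rightarrow> real set \<Rightarrow> ((nat \<Rightarrow> real) \<Rightarrow> real) \<Rightarrow> real_mpoly" where
  "representing_poly n A f =
     (THE p. p \<in> polys n \<and> var_degrees_le p (card A - 1) \<and> represents n A p f)"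

definition fun_degree :: "nat \<Rightarrow> real set \<Rightarrow> ((nat \<Rightarrow> real) \<Rightarrow> real) \<Rightarrow> nat" where
  "fun_degree n A f = total_degree (representing_poly n A f)"

definition hamming_dist :: "nat \<Rightarrow> (nat \<Rightarrow> real) \<Rightarrow> (nat \<Rightarrow> real) \<Rightarrow> nat" where
  "hamming_dist n x y = card {i \<in> {..<n}. x i \<noteq> y i}"

definition local_sensitivity ::
    "nat \<Rightarrow> real set \<Rightarrow> ((nat \<Rightarrow> real) \<Rightarrow> real) \<Rightarrow> (nat \<Rightarrow> real) \<Rightarrow> nat" where
  "local_sensitivity n A f x = card {y \<in> cube n A. hamming_dist n x y = 1 \<and> f y \<noteq> f x}"

definition sensitivity :: "nat \<Rightarrow> real set \<Rightarrow> ((nat \<Rightarrow> real) \<Rightarrow> real) \<Rightarrow> nat" where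
  "sensitivity n A f = Max (local_sensitivity n A f ` cube n A)"

end

theory Submission
  imports Defs "HOL-Computational_Algebra.Polynomial"
begin

text \<open>
  Let \<open>K\<close> be the set of variables of a monomial \<open>u\<close> of maximal degree in the polynomial of \<open>f\<close>;
  then \<open>deg f \<le> card K * (card A - 1)\<close>, so it suffices to show \<open>s(f) \<ge> \<surd>(card K)\<close>. The coefficient of
  \<open>u\<close> is a sum \<open>\<Sum>\<^sub>x f(x) \<Prod>\<^sub>i \<lambda>\<^sub>i(x\<^sub>i)\<close> where \<open>\<lambda>\<^sub>i(a)\<close> is the coefficient of degree \<open>u\<^sub>i\<close> of the Lagrange
  polynomial of \<open>a\<close>. The weights \<open>\<lambda>\<^sub>i\<close> sum to zero for \<open>i \<in> K\<close>, so \<open>f\<close> can be replaced in this sum by its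
  mixed difference over \<open>K\<close> towards a fixed base value \<open>a \<in> A\<close>. Hence some mixed difference is nonzero,
  which means that \<open>f\<close> has full degree on a Boolean subcube with directions \<open>K\<close>. Some level set of
  \<open>f\<close> on this subcube is then correlated with parity, and Huang's eigenvector argument gives a vertex
  with at least \<open>\<surd>(card K)\<close> sensitive directions.
\<close>

section \<open>Underdetermined linear systems over a field\<close>

text \<open>Gaussian elimination, by induction on the equations: an equation with a nonzero
  coefficient at \<open>p\<close> is solved for the unknown at \<open>p\<close> and substituted into
  the others, which removes one equation and one unknown.\<close>

lemma homogeneous_system_nontrivial:
  fixes c :: "'e \<Rightarrow> 'u \<Rightarrow> 'k::field"
  assumes "finite E" "finite U" "card E < card U"
  obtains w where "\<exists>u\<in>U. w u \<noteq> 0" "\<And>e. e \<in> E \<Longrightarrow> (\<Sum>u\<in>U. c e u * w u) = 0"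
proof -
  have "\<exists>w. (\<exists>u\<in>U. w u \<noteq> 0) \<and> (\<forall>e\<in>E. (\<Sum>u\<in>U. c e u * w u) = 0)"
    using assms
  proof (induction E arbitrary: c U rule: finite_induct)
    case empty
    then have "U \<noteq> {}" by auto
    then show ?case by (intro exI[of _ "\<lambda>_. 1"]) auto
  next
    case (insert e E)
    show ?case
    proof (cases "\<forall>u\<in>U. c e u = 0")
      case True
      have "card E < card U" using insert by simp
      from insert.IH[OF \<open>finite U\<close> this, of c] True show ?thesis by auto
    next
      case False
      then obtain p where p: "p \<in> U" "c e p \<noteq> 0" by blast
      have "card E < card (U - {p})" using insert p by simp
      with insert.IH[of "U - {p}" "\<lambda>e' u. c e' u - c e' p * c e u / c e p"] \<open>finite U\<close>
      obtain w u where w: "u \<in> U - {p}" "w u \<noteq> 0"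
        "\<And>e'. e' \<in> E \<Longrightarrow> (\<Sum>u\<in>U - {p}. (c e' u - c e' p * c e u / c e p) * w u) = 0"
        by auto
      define s where "s = (\<Sum>u\<in>U - {p}. c e u * w u)"
      \<comment> \<open>This is the value of the pivot unknown that solves equation
        \<open>e\<close>.\<close>
      define w' where "w' = w(p := - s / c e p)"
      have split: "(\<Sum>u\<in>U. c e' u * w' u) = (\<Sum>u\<in>U - {p}. c e' u * w u) - c e' p * s / c e p" for e'
        using p \<open>finite U\<close> by (simp add: sum.remove[of U p] w'_def)
      have "(\<Sum>u\<in>U. c e u * w' u) = 0"
        using p by (simp add: split s_def)
      moreover have "(\<Sum>u\<in>U. c e' u * w' u) = 0" if "e' \<in> E" for e'
      proof -
        have "(\<Sum>u\<in>U - {p}. (c e' u - c e' p * c e u / c e p) * w u)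
          = (\<Sum>u\<in>U - {p}. c e' u * w u) - c e' p * s / c e p"
          by (simp add: s_def left_diff_distrib sum_subtractf sum_distrib_left sum_divide_distrib
              mult.assoc)
        with w(3)[OF that] show ?thesis by (simp only: split)
      qed
      moreover have "\<exists>u\<in>U. w' u \<noteq> 0" using w(1,2) by (intro bexI[of _ u]) (auto simp: w'_def)
      ultimately show ?thesis by (intro exI[of _ w']) auto
    qed
  qed
  with that show thesis by blast
qed

subsection \<open>Huang's theorem on induced subgraphs of the Boolean cube\<close>

text \<open>Vertices of the Boolean cube are encoded as subsets of the set of directions;
  \<open>flip i\<close> crosses the edge in direction \<open>i\<close>.\<close>

definition flip :: "'a \<Rightarrow> 'a set \<Rightarrow> 'a set" where
  "flip i T = (if i \<in> T then T - {i} else insert i T)"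

lemma flip_flip [simp]: "flip i (flip i T) = T"
  by (auto simp: flip_def)

lemma flip_commute: "flip i (flip j T) = flip j (flip i T)"
  by (auto simp: flip_def)

lemma mem_flip_iff: "j \<in> flip i T \<longleftrightarrow> (if j = i then i \<notin> T else j \<in> T)"
  by (auto simp: flip_def)

lemma flip_subset_iff [simp]: "i \<in> K \<Longrightarrow> flip i T \<subseteq> K \<longleftrightarrow> T \<subseteq> K"
  by (auto simp: flip_def)

lemma minus_one_power_card_flip:
  "finite T \<Longrightarrow> (-1 :: 'a::ring_1) ^ card (flip i T) = - ((-1) ^ card T)"
proof (cases "i \<in> T")
  case True
  assume "finite T"
  from card.remove[OF this True] have "(-1 :: 'a) ^ card T = - ((-1) ^ card (T - {i}))"
    by (simp only: power_Suc) simp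
  with True show ?thesis by (simp add: flip_def)
qed (simp add: flip_def)

text \<open>With these signs every 4-cycle of the cube has an odd number of negative edges, so the paths
  of length two between distinct vertices cancel and the signed adjacency matrix squares to
  \<open>card K\<close> times the identity.\<close>

definition edge_sign :: "'a::linorder set \<Rightarrow> 'a \<Rightarrow> real" where
  "edge_sign T i = (-1) ^ card {j \<in> T. j < i}"

lemma abs_edge_sign [simp]: "\<bar>edge_sign T i\<bar> = 1"
  by (simp add: edge_sign_def)

lemma edge_sign_sq [simp]: "edge_sign T i * edge_sign T i = 1"
  by (simp add: edge_sign_def flip: power_add mult_2)

lemma edge_sign_nonzero [simp]: "edge_sign T i \<noteq> 0"
  by (simp add: edge_sign_def)

lemma edge_sign_flip:
  assumes "finite T"
  shows "edge_sign (flip i T) j = (if i < j then - edge_sign T j else edge_sign T j)"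
proof (cases "i < j")
  case True
  then have "{k \<in> flip i T. k < j} = flip i {k \<in> T. k < j}"
    by (auto simp: flip_def)
  with True assms show ?thesis by (simp add: edge_sign_def minus_one_power_card_flip)
next
  case False
  then have "{k \<in> flip i T. k < j} = {k \<in> T. k < j}"
    by (auto simp: flip_def)
  with False show ?thesis by (simp add: edge_sign_def)
qed

definition signed_adjacency :: "'a::linorder set \<Rightarrow> ('a set \<Rightarrow> real) \<Rightarrow> 'a set \<Rightarrow> real" where
  "signed_adjacency K v T = (\<Sum>i\<in>K. edge_sign T i * v (flip i T))"

lemma sum_antisymmetric:
  fixes G :: "'a \<Rightarrow> 'a \<Rightarrow> real"
  assumes "\<And>i j. i \<in> K \<Longrightarrow> j \<in> K \<Longrightarrow> G i j = - G j i"
  shows "(\<Sum>i\<in>K. \<Sum>j\<in>K. G i j) = 0"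
proof -
  have "(\<Sum>i\<in>K. \<Sum>j\<in>K. G i j) = (\<Sum>j\<in>K. \<Sum>i\<in>K. G i j)" by (rule sum.swap)
  also have "\<dots> = (\<Sum>j\<in>K. \<Sum>i\<in>K. - G j i)" by (intro sum.cong refl assms)
  also have "\<dots> = - (\<Sum>i\<in>K. \<Sum>j\<in>K. G i j)" by (simp add: sum_negf)
  finally show ?thesis by simp
qed

lemma signed_adjacency_squared:
  fixes v :: "'a::linorder set \<Rightarrow> real"
  assumes "finite K" "T \<subseteq> K"
  shows "signed_adjacency K (signed_adjacency K v) T = card K * v T"
proof -
  have fin: "finite T" using assms finite_subset by blast
  define F where "F i j = edge_sign T i * edge_sign (flip i T) j * v (flip j (flip i T))" for i j
  define G where "G i j = (if i = j then 0 else F i j)" for i j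
  \<comment> \<open>For \<open>i \<noteq> j\<close> both orders of flipping reach the same vertex.
    Only the order that flips the smaller direction first changes the sign of the second edge, so
    the two contributions are opposite.\<close>
  have anti: "G i j = - G j i" for i j
    using flip_commute[of i j T]
    by (cases i j rule: linorder_cases) (auto simp: G_def F_def edge_sign_flip fin)
  have "signed_adjacency K (signed_adjacency K v) T = (\<Sum>i\<in>K. \<Sum>j\<in>K. F i j)"
    by (simp add: signed_adjacency_def F_def sum_distrib_left mult.assoc)
  also have "\<dots> = (\<Sum>i\<in>K. \<Sum>j\<in>K. G i j + (if i = j then v T else 0))"
    by (intro sum.cong refl) (auto simp: G_def F_def edge_sign_flip fin)
  also have "\<dots> = (\<Sum>i\<in>K. \<Sum>j\<in>K. G i j) + card K * v T"
    using assms by (simp add: sum.distrib)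
  also have "(\<Sum>i\<in>K. \<Sum>j\<in>K. G i j) = 0" using anti by (rule sum_antisymmetric)
  finally show ?thesis by simp
qed

lemma signed_adjacency_add_scaled:
  "signed_adjacency K (\<lambda>T. u T + r * v T) T = signed_adjacency K u T + r * signed_adjacency K v T"
  by (simp add: signed_adjacency_def algebra_simps sum.distrib sum_distrib_left)

text \<open>Write \<open>M\<close> for the signed adjacency operator and \<open>k\<close> for \<open>card K\<close>.
  Every \<open>M z + \<surd>k z\<close> is an eigenvector of \<open>M\<close>. Taking \<open>z\<close> supported on a half cube makes
  \<open>z \<mapsto> M z + \<surd>k z\<close> injective and leaves \<open>2\<^sup>k\<^sup>-\<^sup>1\<close> unknowns, more than the vertices outside \<open>S\<close>.\<close>

lemma signed_adjacency_eigenvector: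
  assumes "finite K" "K \<noteq> {}" "S \<subseteq> Pow K" "2 ^ card K < 2 * card S"
  obtains v where "\<And>T. T \<in> Pow K - S \<Longrightarrow> v T = 0" "\<exists>T\<in>Pow K. v T \<noteq> 0"
    "\<And>T. T \<in> Pow K \<Longrightarrow> signed_adjacency K v T = sqrt (card K) * v T"
proof -
  define r where "r = sqrt (card K)"
  obtain k where k: "k \<in> K" using assms(2) by blast
  define U where "U = Pow (K - {k})"
  \<comment> \<open>\<open>c T u\<close> is the entry of \<open>M + r I\<close> in row
    \<open>T\<close> and column \<open>u\<close>. The system therefore says that
    \<open>M z + r z\<close>, with \<open>z\<close> supported on \<open>U\<close>, vanishes at the
    vertices outside \<open>S\<close>.\<close>
  define c where
    "c T u = (if u = T then r else 0) + (\<Sum>i\<in>K. if u = flip i T then edge_sign T i else 0)" for T u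
  have "card K = Suc (card (K - {k}))"
    using assms(1) k by (rule card.remove)
  then have "2 ^ card K = 2 * card U"
    using assms(1) by (simp only: U_def card_Pow finite_Diff power_Suc)
  moreover have "card (Pow K - S) = 2 ^ card K - card S"
    using assms by (simp add: card_Diff_subset finite_subset card_Pow)
  moreover have "card U > 0" using assms(1) by (simp add: U_def card_Pow)
  ultimately have "card (Pow K - S) < card U" using assms(4) by linarith
  moreover have "finite (Pow K - S)" "finite U" using assms(1) by (auto simp: U_def)
  ultimately obtain w where "\<exists>u\<in>U. w u \<noteq> 0"
    and w_eq: "\<And>T. T \<in> Pow K - S \<Longrightarrow> (\<Sum>u\<in>U. c T u * w u) = 0"
    using homogeneous_system_nontrivial[of "Pow K - S" U c] by metis
  then obtain u where w: "u \<in> U" "w u \<noteq> 0" by blast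
  define z where "z T = (if T \<in> U then w T else 0)" for T
  define v where "v T = signed_adjacency K z T + r * z T" for T
  have finU: "finite U" using assms(1) by (simp add: U_def)
  have "v T = (\<Sum>u\<in>U. c T u * w u)" for T
  proof -
    have "(\<Sum>u\<in>U. c T u * w u) =
      (\<Sum>u\<in>U. if u = T then r * w u else 0)
      + (\<Sum>u\<in>U. \<Sum>i\<in>K. if u = flip i T then edge_sign T i * w u else 0)"
      by (simp add: c_def ring_distribs sum.distrib sum_distrib_right if_distrib[of "\<lambda>x. x * _"]
          cong: if_cong)
    also have "(\<Sum>u\<in>U. \<Sum>i\<in>K. if u = flip i T then edge_sign T i * w u else 0)
      = (\<Sum>i\<in>K. \<Sum>u\<in>U. if u = flip i T then edge_sign T i * w u else 0)"
      by (rule sum.swap)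
    also have "(\<Sum>u\<in>U. if u = T then r * w u else 0) = r * z T"
      using finU by (simp add: z_def)
    also have "(\<Sum>i\<in>K. \<Sum>u\<in>U. if u = flip i T then edge_sign T i * w u else 0)
      = signed_adjacency K z T"
      unfolding signed_adjacency_def using finU by (intro sum.cong refl) (simp add: z_def)
    finally show ?thesis by (simp add: v_def)
  qed
  with w_eq have "v T = 0" if "T \<in> Pow K - S" for T using that by simp
  moreover have "signed_adjacency K v T = sqrt (card K) * v T" if "T \<in> Pow K" for T
  proof -
    have "signed_adjacency K v T = card K * z T + r * signed_adjacency K z T"
      using that assms(1) by (simp add: v_def [abs_def] signed_adjacency_add_scaled signed_adjacency_squared)
    also have "\<dots> = r * v T"
      by (simp add: v_def r_def algebra_simps)
    finally show ?thesis by (simp add: r_def)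
  qed
  \<comment> \<open>The only neighbour of \<open>insert k u\<close> in the half cube is
    \<open>u\<close>, so the value here is \<open>w u\<close> up to sign. This is where injectivity
    on the half cube enters.\<close>
  moreover have "v (insert k u) \<noteq> 0"
  proof -
    have ku: "k \<notin> u" "u \<subseteq> K" using w(1) by (auto simp: U_def)
    have "z (insert k u) = 0" by (simp add: z_def U_def)
    moreover have "signed_adjacency K z (insert k u) =
      (\<Sum>i\<in>K. if i = k then edge_sign (insert k u) k * w u else 0)"
      unfolding signed_adjacency_def
      using ku w(1) by (intro sum.cong refl) (auto simp: z_def U_def flip_def)
    ultimately show ?thesis using assms(1) k w(2) by (simp add: v_def)
  qed
  moreover have "insert k u \<in> Pow K" using w(1) k by (auto simp: U_def)
  ultimately show thesis using that by blast
qed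

text \<open>At a vertex \<open>T\<close> maximizing \<open>\<bar>v T\<bar>\<close>, the eigenvalue
  equation writes \<open>sqrt (card K) * v T\<close> as a signed sum over neighbours. Those outside
  \<open>S\<close> contribute zero, and each of the others at most
  \<open>\<bar>v T\<bar>\<close>.\<close>

lemma induced_subcube_degree:
  fixes K :: "'a::linorder set"
  assumes "finite K" "S \<subseteq> Pow K" "2 ^ card K < 2 * card S"
  obtains T where "T \<in> S" "sqrt (card K) \<le> card {i \<in> K. flip i T \<in> S}"
proof (cases "K = {}")
  case True
  moreover have "S \<noteq> {}" using assms(3) by auto
  ultimately show thesis using that by auto
next
  case False
  from signed_adjacency_eigenvector[OF assms(1) False assms(2,3)]
  obtain v where v: "\<And>T. T \<in> Pow K - S \<Longrightarrow> v T = 0" "\<exists>T\<in>Pow K. v T \<noteq> 0"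
    "\<And>T. T \<in> Pow K \<Longrightarrow> signed_adjacency K v T = sqrt (card K) * v T"
    by blast
  define m where "m = Max ((\<lambda>T. \<bar>v T\<bar>) ` Pow K)"
  have le: "\<bar>v T\<bar> \<le> m" if "T \<in> Pow K" for T
    unfolding m_def using assms(1) that by (intro Max_ge) auto
  have "m \<in> (\<lambda>T. \<bar>v T\<bar>) ` Pow K"
    unfolding m_def using assms(1) by (intro Max_in) auto
  then obtain T where T: "T \<in> Pow K" "m = \<bar>v T\<bar>" by auto
  obtain T' where "T' \<in> Pow K" "v T' \<noteq> 0" using v(2) by blast
  then have "m > 0" using le[of T'] by linarith
  then have "T \<in> S" using v(1)[of T] T by auto
  have "sqrt (card K) * m = \<bar>signed_adjacency K v T\<bar>"
    using T v(3) by (simp add: abs_mult)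
  also have "\<dots> \<le> (\<Sum>i\<in>K. \<bar>edge_sign T i * v (flip i T)\<bar>)"
    unfolding signed_adjacency_def by (rule sum_abs)
  also have "\<dots> \<le> (\<Sum>i\<in>K. if flip i T \<in> S then m else 0)"
    using T le v(1) by (intro sum_mono) (auto simp: abs_mult)
  also have "\<dots> = card {i \<in> K. flip i T \<in> S} * m"
    using assms(1) by (simp add: sum.If_cases Int_def)
  finally show thesis using that \<open>T \<in> S\<close> \<open>m > 0\<close> by simp
qed

section \<open>From large vertex sets to functions on the Boolean cube\<close>

lemma majority_of_signs:
  fixes e :: "'a \<Rightarrow> real"
  assumes "finite P" "\<And>T. T \<in> P \<Longrightarrow> e T = 1 \<or> e T = -1" "(\<Sum>T\<in>P. e T) \<noteq> 0"
  obtains c where "card P < 2 * card {T \<in> P. e T = c}"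
proof -
  define X where "X = {T \<in> P. e T = 1}"
  define Y where "Y = {T \<in> P. e T = -1}"
  have P: "P = X \<union> Y" "X \<inter> Y = {}" "finite X" "finite Y"
    using assms(1,2) by (auto simp: X_def Y_def)
  have "(\<Sum>T\<in>P. e T) = (\<Sum>T\<in>X. e T) + (\<Sum>T\<in>Y. e T)"
    using P by (simp add: sum.union_disjoint)
  also have "\<dots> = real (card X) - real (card Y)"
    by (simp add: X_def Y_def)
  finally have "card X \<noteq> card Y" using assms(3) by auto
  moreover have "card P = card X + card Y" using P by (simp add: card_Un_disjoint)
  ultimately have "card P < 2 * card X \<or> card P < 2 * card Y" by linarith
  then show thesis using that by (auto simp: X_def Y_def)
qed

text \<open>Some level set of \<open>g\<close> has nonzero correlation with parity. Its plus-minus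
  indicator times parity then takes one sign on more than half of the cube, and Huang's theorem
  applies to that majority.\<close>

lemma sensitive_vertex_of_boolean_cube:
  fixes K :: "'a::linorder set" and g :: "'a set \<Rightarrow> real"
  assumes "finite K" and nz: "(\<Sum>T\<in>Pow K. (-1) ^ card T * g T) \<noteq> 0"
  obtains T where "T \<subseteq> K" "sqrt (card K) \<le> card {i \<in> K. g (flip i T) \<noteq> g T}"
proof (cases "K = {}")
  case True
  then show thesis using that by auto
next
  case False
  \<comment> \<open>The function \<open>g\<close> is decomposed into indicators of its level sets,
    weighted by its finitely many values \<open>b\<close>.\<close>
  have "(-1) ^ card T * g T = (\<Sum>b\<in>g ` Pow K. b * ((-1) ^ card T * of_bool (g T = b)))"
    if "T \<in> Pow K" for T
  proof -
    have "(\<Sum>b\<in>g ` Pow K. b * ((-1) ^ card T * of_bool (g T = b)))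
      = (\<Sum>b\<in>g ` Pow K. if g T = b then (-1) ^ card T * b else 0)"
      by (intro sum.cong refl) simp
    also have "\<dots> = (-1) ^ card T * g T"
      using that assms(1) by (subst sum.delta') auto
    finally show ?thesis by simp
  qed
  then have "(\<Sum>T\<in>Pow K. (-1) ^ card T * g T)
    = (\<Sum>T\<in>Pow K. \<Sum>b\<in>g ` Pow K. b * ((-1) ^ card T * of_bool (g T = b)))"
    by (rule sum.cong[OF refl])
  also have "\<dots> = (\<Sum>b\<in>g ` Pow K. b * (\<Sum>T\<in>Pow K. (-1) ^ card T * of_bool (g T = b)))"
    by (subst sum.swap) (simp add: sum_distrib_left)
  finally obtain b where b: "(\<Sum>T\<in>Pow K. (-1 :: real) ^ card T * of_bool (g T = b)) \<noteq> 0"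
    using nz by (metis (no_types, lifting) mult_zero_right sum.neutral)
  \<comment> \<open>Adjacent vertices at which \<open>e\<close> takes the same value are separated by \<open>g\<close>.\<close>
  define e :: "'a set \<Rightarrow> real" where "e T = (-1) ^ card T * (2 * of_bool (g T = b) - 1)" for T
  \<comment> \<open>Expanding the product of \<open>1 - 1\<close> over the nonempty set
    \<open>K\<close> shows that parity sums to zero, so the sum of \<open>e\<close> is twice the
    nonzero correlation.\<close>
  have "(\<Sum>T\<in>Pow K. (-1 :: real) ^ card T) = 0"
    using prod_diff_conv_sum[OF assms(1), of "\<lambda>_. 1 :: real" "\<lambda>_. 1"] assms(1) False
    by (simp add: power_0_left)
  then have "(\<Sum>T\<in>Pow K. e T) \<noteq> 0"
    using b by (simp add: e_def algebra_simps sum_subtractf flip: sum_distrib_left)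
  moreover have "e T = 1 \<or> e T = -1" for T
    by (cases "even (card T)") (auto simp: e_def)
  ultimately obtain c where c: "card (Pow K) < 2 * card {T \<in> Pow K. e T = c}"
    using majority_of_signs[of "Pow K" e] assms(1) by auto
  define S where "S = {T \<in> Pow K. e T = c}"
  have "S \<subseteq> Pow K" by (auto simp: S_def)
  moreover have "2 ^ card K < 2 * card S" using c assms(1) by (simp add: S_def card_Pow)
  ultimately obtain T where T: "T \<in> S" "sqrt (card K) \<le> card {i \<in> K. flip i T \<in> S}"
    using induced_subcube_degree[of K S] assms(1) by metis
  have "finite T" using T(1) assms(1) by (auto simp: S_def intro: finite_subset)
  then have "card {i \<in> K. flip i T \<in> S} \<le> card {i \<in> K. g (flip i T) \<noteq> g T}"
    using assms(1) T(1)
    by (intro card_mono) (auto simp: S_def e_def minus_one_power_card_flip split: if_splits)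
  with T show thesis using that by (auto simp: S_def)
qed

subsection \<open>Interpolation on the grid\<close>

definition lagrange_poly :: "'a::field set \<Rightarrow> 'a \<Rightarrow> 'a poly" where
  "lagrange_poly A a = (\<Prod>b\<in>A - {a}. smult (1 / (a - b)) [:- b, 1:])"

lemma poly_lagrange_poly:
  assumes "finite A" "a \<in> A" "b \<in> A"
  shows "poly (lagrange_poly A a) b = of_bool (a = b)"
proof (cases "a = b")
  case True
  then show ?thesis by (auto simp: lagrange_poly_def poly_prod simp flip: diff_divide_distrib intro!: prod.neutral split: if_splits)
next
  case False
  then have "\<exists>c\<in>A - {a}. poly (smult (1 / (a - c)) [:- c, 1:]) b = 0"
    using assms(3) by (intro bexI[of _ b]) auto
  with False assms(1) show ?thesis
    unfolding lagrange_poly_def poly_prod by (subst prod_zero) auto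
qed

lemma degree_lagrange_poly:
  assumes "finite A" "a \<in> A"
  shows "degree (lagrange_poly A a) \<le> card A - 1"
proof -
  have "degree (lagrange_poly A a)
    \<le> (\<Sum>b\<in>A - {a}. (degree \<circ> (\<lambda>b. smult (1 / (a - b)) [:- b, 1:])) b)"
    unfolding lagrange_poly_def using assms(1) by (intro degree_prod_sum_le) auto
  also have "\<dots> \<le> (\<Sum>b\<in>A - {a}. 1)"
    by (intro sum_mono) auto
  finally show ?thesis using assms by simp
qed

text \<open>For finite nonempty \<open>A\<close> these are the entries of the inverse of the
  Vandermonde matrix of \<open>A\<close>; the next two lemmas are the two matrix products.\<close>

definition dual_weight :: "'a::field set \<Rightarrow> nat \<Rightarrow> 'a \<Rightarrow> 'a" where
  "dual_weight A j a = coeff (lagrange_poly A a) j"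

text \<open>Interpolating the monomial of degree \<open>l < card A\<close> reproduces it; the claim
  compares coefficients. For \<open>l = 0\<close> and \<open>j > 0\<close> it says that the weights
  sum to zero.\<close>

lemma sum_dual_weight_points:
  assumes "finite A" "l < card A"
  shows "(\<Sum>a\<in>A. dual_weight A j a * a ^ l) = of_bool (j = l)"
proof -
  define P where "P = (\<Sum>a\<in>A. smult (a ^ l) (lagrange_poly A a))"
  have "P = monom 1 l"
  proof (rule poly_eqI_degree)
    fix b assume "b \<in> A"
    then have "poly P b = (\<Sum>a\<in>A. if a = b then b ^ l else 0)"
      unfolding P_def poly_sum using assms(1)
      by (intro sum.cong refl) (simp add: poly_lagrange_poly)
    with \<open>b \<in> A\<close> assms(1) show "poly P b = poly (monom 1 l) b"
      by (simp add: poly_monom)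
  next
    have "degree P \<le> card A - 1"
      unfolding P_def using assms(1)
      by (intro degree_sum_le order_trans[OF degree_smult_le degree_lagrange_poly])
    with assms(2) show "degree P < card A" by simp
  qed (use assms(2) in \<open>simp add: degree_monom_eq\<close>)
  then have "coeff P j = of_bool (j = l)" by simp
  then show ?thesis by (simp add: P_def coeff_sum dual_weight_def mult.commute)
qed

lemma sum_dual_weight_exponents:
  assumes "finite A" "a \<in> A" "b \<in> A"
  shows "(\<Sum>j\<le>card A - 1. dual_weight A j a * b ^ j) = of_bool (a = b)"
proof -
  have "(\<Sum>j\<le>card A - 1. dual_weight A j a * b ^ j) = poly (lagrange_poly A a) b"
    unfolding poly_altdef dual_weight_def using degree_lagrange_poly[OF assms(1,2)]
    by (intro sum.mono_neutral_right) (auto simp: coeff_eq_0)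
  with poly_lagrange_poly[OF assms] show ?thesis by simp
qed

section \<open>Monomials of bounded exponents and multivariate interpolation\<close>

definition exponents :: "nat \<Rightarrow> nat \<Rightarrow> (nat \<Rightarrow>\<^sub>0 nat) set" where
  "exponents n d =
    {u. Poly_Mapping.keys u \<subseteq> {..<n} \<and> (\<forall>i. Poly_Mapping.lookup u i \<le> d)}"

lemma keys_subset_exponents:
  "p \<in> polys n \<Longrightarrow> var_degrees_le p d \<Longrightarrow> Poly_Mapping.keys p \<subseteq> exponents n d"
  by (auto simp: polys_def var_degrees_le_def exponents_def)

text \<open>This turns sums over monomials into sums over a function space, where sums of products
  factor coordinatewise.\<close>

lemma bij_betw_exponents:
  "bij_betw (\<lambda>u. restrict (Poly_Mapping.lookup u) {..<n}) (exponents n d) ({..<n} \<rightarrow>\<^sub>E {..d})"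
proof (rule bij_betwI')
  fix u v assume uv: "u \<in> exponents n d" "v \<in> exponents n d"
  have "u = v"
    if eq: "restrict (Poly_Mapping.lookup u) {..<n} = restrict (Poly_Mapping.lookup v) {..<n}"
  proof (rule poly_mapping_eqI)
    fix i
    show "Poly_Mapping.lookup u i = Poly_Mapping.lookup v i"
    proof (cases "i < n")
      case True
      with fun_cong[OF eq, of i] show ?thesis by simp
    next
      case False
      with uv have "i \<notin> Poly_Mapping.keys u" "i \<notin> Poly_Mapping.keys v"
        by (auto simp: exponents_def)
      then show ?thesis by (simp add: in_keys_iff)
    qed
  qed
  then show "restrict (Poly_Mapping.lookup u) {..<n} = restrict (Poly_Mapping.lookup v) {..<n}
    \<longleftrightarrow> u = v" by auto
next
  fix u assume "u \<in> exponents n d"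
  then show "restrict (Poly_Mapping.lookup u) {..<n} \<in> {..<n} \<rightarrow>\<^sub>E {..d}"
    by (auto simp: exponents_def)
next
  fix g assume g: "g \<in> {..<n} \<rightarrow>\<^sub>E {..d}"
  define u where "u = Abs_poly_mapping (\<lambda>i. if i < n then g i else 0)"
  have "finite {i. (if i < n then g i else 0) \<noteq> 0}"
    by (rule finite_subset[of _ "{..<n}"]) auto
  then have lu: "Poly_Mapping.lookup u = (\<lambda>i. if i < n then g i else 0)"
    by (simp add: u_def)
  then have "u \<in> exponents n d"
    using g by (fastforce simp: exponents_def in_keys_iff split: if_splits)
  moreover have "g = restrict (Poly_Mapping.lookup u) {..<n}"
    using g by (auto simp: lu restrict_def PiE_def extensional_def)
  ultimately show "\<exists>u\<in>exponents n d. g = restrict (Poly_Mapping.lookup u) {..<n}" by blast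
qed

lemma finite_exponents: "finite (exponents n d)"
  using bij_betw_finite[OF bij_betw_exponents[of n d]] by (simp add: finite_PiE)

lemma sum_exponents_prod:
  fixes h :: "nat \<Rightarrow> nat \<Rightarrow> 'a::comm_semiring_1"
  shows "(\<Sum>u\<in>exponents n d. \<Prod>i<n. h i (Poly_Mapping.lookup u i)) = (\<Prod>i<n. \<Sum>j\<le>d. h i j)"
proof -
  have "(\<Sum>u\<in>exponents n d. \<Prod>i<n. h i (Poly_Mapping.lookup u i))
    = (\<Sum>u\<in>exponents n d. \<Prod>i<n. h i (restrict (Poly_Mapping.lookup u) {..<n} i))"
    by (intro sum.cong prod.cong refl) auto
  also have "\<dots> = (\<Sum>g\<in>{..<n} \<rightarrow>\<^sub>E {..d}. \<Prod>i<n. h i (g i))"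
    by (rule sum.reindex_bij_betw[OF bij_betw_exponents])
  also have "\<dots> = (\<Prod>i<n. \<Sum>j\<le>d. h i j)"
    by (rule prod_sum_PiE[symmetric]) auto
  finally show ?thesis .
qed

lemma prod_keys_eq:
  fixes x :: "nat \<Rightarrow> real"
  assumes "u \<in> exponents n d"
  shows "(\<Prod>i\<in>Poly_Mapping.keys u. x i ^ Poly_Mapping.lookup u i)
    = (\<Prod>i<n. x i ^ Poly_Mapping.lookup u i)"
  using assms by (intro prod.mono_neutral_left) (auto simp: exponents_def in_keys_iff)

lemma eval_mpoly_exponents:
  assumes "Poly_Mapping.keys p \<subseteq> exponents n d"
  shows "eval_mpoly p x =
    (\<Sum>u\<in>exponents n d. Poly_Mapping.lookup p u * (\<Prod>i<n. x i ^ Poly_Mapping.lookup u i))"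
proof -
  have "eval_mpoly p x =
    (\<Sum>u\<in>Poly_Mapping.keys p. Poly_Mapping.lookup p u * (\<Prod>i<n. x i ^ Poly_Mapping.lookup u i))"
    unfolding eval_mpoly_def using assms by (intro sum.cong refl arg_cong2[where f = "(*)"] prod_keys_eq) auto
  also have "\<dots> =
    (\<Sum>u\<in>exponents n d. Poly_Mapping.lookup p u * (\<Prod>i<n. x i ^ Poly_Mapping.lookup u i))"
    using assms by (intro sum.mono_neutral_left) (auto simp: finite_exponents in_keys_iff)
  finally show ?thesis .
qed

lemma finite_cube [simp]: "finite A \<Longrightarrow> finite (cube n A)"
  by (simp add: cube_def finite_PiE)

lemma prod_of_bool:
  "finite I \<Longrightarrow> (\<Prod>i\<in>I. of_bool (P i) :: 'a::comm_semiring_1) = of_bool (\<forall>i\<in>I. P i)"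
  by (induction I rule: finite_induct) auto

text \<open>Products of one-variable dual weights are biorthogonal to the monomials on the grid, so
  pairing with them extracts a coefficient. In particular the values on the grid determine the
  polynomial.\<close>

lemma lookup_eq_sum_cube:
  assumes "finite A" "card A > 0" "Poly_Mapping.keys p \<subseteq> exponents n (card A - 1)"
    and u: "u \<in> exponents n (card A - 1)"
  shows "Poly_Mapping.lookup p u =
    (\<Sum>x\<in>cube n A. (\<Prod>i<n. dual_weight A (Poly_Mapping.lookup u i) (x i)) * eval_mpoly p x)"
proof -
  define U where "U = exponents n (card A - 1)"
  have orth: "(\<Sum>x\<in>cube n A. \<Prod>i<n. dual_weight A (Poly_Mapping.lookup u i) (x i) * x i ^ Poly_Mapping.lookup v i)
    = of_bool (v = u)" if v: "v \<in> U" for v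
  proof -
    have lt: "Poly_Mapping.lookup v i < card A" for i
    proof -
      have "Poly_Mapping.lookup v i \<le> card A - 1" using v by (simp add: U_def exponents_def)
      with assms(2) show ?thesis by linarith
    qed
    have "(\<Sum>x\<in>cube n A. \<Prod>i<n. dual_weight A (Poly_Mapping.lookup u i) (x i) * x i ^ Poly_Mapping.lookup v i)
      = (\<Prod>i<n. \<Sum>a\<in>A. dual_weight A (Poly_Mapping.lookup u i) a * a ^ Poly_Mapping.lookup v i)"
      unfolding cube_def using assms(1) by (intro prod_sum_PiE[symmetric]) auto
    also have "\<dots> = of_bool (\<forall>i\<in>{..<n}. Poly_Mapping.lookup u i = Poly_Mapping.lookup v i)"
      using assms(1) lt by (simp add: sum_dual_weight_points prod_of_bool)
    also have "(\<forall>i\<in>{..<n}. Poly_Mapping.lookup u i = Poly_Mapping.lookup v i) \<longleftrightarrow>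
      restrict (Poly_Mapping.lookup v) {..<n} = restrict (Poly_Mapping.lookup u) {..<n}"
      by (auto simp: restrict_def fun_eq_iff)
    also have "\<dots> \<longleftrightarrow> v = u"
      using u v by (intro inj_on_eq_iff[OF bij_betw_imp_inj_on[OF bij_betw_exponents]]) (simp_all add: U_def)
    finally show ?thesis .
  qed
  have "(\<Sum>x\<in>cube n A. (\<Prod>i<n. dual_weight A (Poly_Mapping.lookup u i) (x i)) * eval_mpoly p x)
    = (\<Sum>x\<in>cube n A. \<Sum>v\<in>U. Poly_Mapping.lookup p v *
        (\<Prod>i<n. dual_weight A (Poly_Mapping.lookup u i) (x i) * x i ^ Poly_Mapping.lookup v i))"
    by (simp add: eval_mpoly_exponents[OF assms(3)] U_def sum_distrib_left prod.distrib mult.left_commute)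
  also have "\<dots> = (\<Sum>v\<in>U. Poly_Mapping.lookup p v *
      (\<Sum>x\<in>cube n A. \<Prod>i<n. dual_weight A (Poly_Mapping.lookup u i) (x i) * x i ^ Poly_Mapping.lookup v i))"
    by (subst sum.swap) (simp add: sum_distrib_left)
  also have "\<dots> = (\<Sum>v\<in>U. if v = u then Poly_Mapping.lookup p v else 0)"
    by (intro sum.cong refl) (simp add: orth)
  also have "\<dots> = Poly_Mapping.lookup p u"
    using u by (simp add: U_def finite_exponents)
  finally show ?thesis by simp
qed

lemma representing_poly_unique:
  assumes "finite A" "card A > 0"
    and "Poly_Mapping.keys p \<subseteq> exponents n (card A - 1)" "represents n A p f"
    and "Poly_Mapping.keys q \<subseteq> exponents n (card A - 1)" "represents n A q f"
  shows "p = q"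
proof (rule poly_mapping_eqI)
  fix u
  show "Poly_Mapping.lookup p u = Poly_Mapping.lookup q u"
  proof (cases "u \<in> exponents n (card A - 1)")
    case True
    show ?thesis
      using assms(4,6) unfolding lookup_eq_sum_cube[OF assms(1-3) True]
        lookup_eq_sum_cube[OF assms(1,2,5) True]
      by (intro sum.cong refl) (simp add: represents_def)
  next
    case False
    then have "u \<notin> Poly_Mapping.keys p" "u \<notin> Poly_Mapping.keys q" using assms(3,5) by auto
    then show ?thesis by (simp add: in_keys_iff)
  qed
qed

lemma interpolation_exists:
  assumes "finite A"
  obtains p where "Poly_Mapping.keys p \<subseteq> exponents n (card A - 1)" "represents n A p f"
proof -
  define U where "U = exponents n (card A - 1)"
  \<comment> \<open>This is the coefficient at \<open>u\<close> of the sum over \<open>y\<close> of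
    \<open>f y\<close> times the product of the Lagrange polynomials of the coordinates of
    \<open>y\<close>. On the grid that product is the indicator of \<open>y\<close>.\<close>
  define c where "c u = (\<Sum>y\<in>cube n A.
    f y * (\<Prod>i<n. dual_weight A (Poly_Mapping.lookup u i) (y i)))" for u
  define p where "p = Abs_poly_mapping (\<lambda>u. if u \<in> U then c u else 0)"
  have "finite {u. (if u \<in> U then c u else 0) \<noteq> 0}"
    by (rule finite_subset[of _ U]) (auto simp: U_def finite_exponents)
  then have lp: "Poly_Mapping.lookup p = (\<lambda>u. if u \<in> U then c u else 0)"
    by (simp add: p_def)
  then have keys: "Poly_Mapping.keys p \<subseteq> U"
    by (auto simp: in_keys_iff split: if_splits)
  have "eval_mpoly p x = f x" if x: "x \<in> cube n A" for x
  proof -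
    have "eval_mpoly p x = (\<Sum>u\<in>U. c u * (\<Prod>i<n. x i ^ Poly_Mapping.lookup u i))"
      using keys unfolding U_def by (subst eval_mpoly_exponents) (auto simp: lp U_def)
    also have "\<dots> = (\<Sum>u\<in>U. \<Sum>y\<in>cube n A. f y *
      (\<Prod>i<n. dual_weight A (Poly_Mapping.lookup u i) (y i) * x i ^ Poly_Mapping.lookup u i))"
      by (simp add: c_def sum_distrib_right prod.distrib mult.assoc)
    also have "\<dots> = (\<Sum>y\<in>cube n A. f y *
      (\<Sum>u\<in>U. \<Prod>i<n. dual_weight A (Poly_Mapping.lookup u i) (y i) * x i ^ Poly_Mapping.lookup u i))"
      by (subst sum.swap) (simp add: sum_distrib_left)
    also have "\<dots> = (\<Sum>y\<in>cube n A. if y = x then f y else 0)"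
    proof (intro sum.cong refl)
      fix y assume y: "y \<in> cube n A"
      have "(\<Sum>u\<in>U. \<Prod>i<n. dual_weight A (Poly_Mapping.lookup u i) (y i) * x i ^ Poly_Mapping.lookup u i)
        = (\<Prod>i<n. \<Sum>j\<le>card A - 1. dual_weight A j (y i) * x i ^ j)"
        unfolding U_def by (rule sum_exponents_prod)
      also have "\<dots> = (\<Prod>i<n. of_bool (y i = x i))"
        using x y assms by (intro prod.cong refl sum_dual_weight_exponents) (auto simp: cube_def)
      also have "\<dots> = of_bool (y = x)"
        using PiE_ext[of y "{..<n}" "\<lambda>_. A" x] x y unfolding cube_def
        by (subst prod_of_bool) auto
      finally show "f y * (\<Sum>u\<in>U. \<Prod>i<n.
          dual_weight A (Poly_Mapping.lookup u i) (y i) * x i ^ Poly_Mapping.lookup u i)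
        = (if y = x then f y else 0)" by simp
    qed
    also have "\<dots> = f x" using x assms by simp
    finally show ?thesis .
  qed
  with keys that show thesis by (auto simp: represents_def U_def)
qed

lemma representing_poly:
  assumes "finite A" "card A > 0"
  shows "Poly_Mapping.keys (representing_poly n A f) \<subseteq> exponents n (card A - 1)"
    and "represents n A (representing_poly n A f) f"
proof -
  obtain p where p: "Poly_Mapping.keys p \<subseteq> exponents n (card A - 1)" "represents n A p f"
    using interpolation_exists[OF assms(1)] by metis
  have "representing_poly n A f = p"
    unfolding representing_poly_def
  proof (rule the_equality)
    show "p \<in> polys n \<and> var_degrees_le p (card A - 1) \<and> represents n A p f"
      using p by (auto simp: polys_def var_degrees_le_def exponents_def)
  next
    fix q assume "q \<in> polys n \<and> var_degrees_le q (card A - 1) \<and> represents n A q f"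
    then show "q = p"
      using representing_poly_unique[OF assms _ _ p] keys_subset_exponents by blast
  qed
  with p show "Poly_Mapping.keys (representing_poly n A f) \<subseteq> exponents n (card A - 1)"
    and "represents n A (representing_poly n A f) f" by simp_all
qed

subsection \<open>From the grid to a Boolean cube\<close>

text \<open>Since \<open>G\<close> ignores coordinate \<open>t\<close>, the sum over that coordinate
  factors out as the vanishing sum of \<open>w t\<close>.\<close>

lemma sum_PiE_prod_eq_0:
  fixes w :: "'i \<Rightarrow> 'b \<Rightarrow> 'c::comm_semiring_1"
  assumes "finite I" "t \<in> I" "(\<Sum>a\<in>A. w t a) = 0"
    and G: "\<And>x a. G (x(t := a)) = G x"
  shows "(\<Sum>x\<in>I \<rightarrow>\<^sub>E A. (\<Prod>i\<in>I. w i (x i)) * G x) = 0"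
proof -
  define J where "J = I - {t}"
  have J: "I = insert t J" "t \<notin> J" "finite J" using assms by (auto simp: J_def)
  have "(\<Sum>x\<in>I \<rightarrow>\<^sub>E A. (\<Prod>i\<in>I. w i (x i)) * G x)
    = (\<Sum>(a, y)\<in>A \<times> (J \<rightarrow>\<^sub>E A). (\<Prod>i\<in>I. w i ((y(t := a)) i)) * G (y(t := a)))"
    unfolding J(1) PiE_insert_eq using inj_combinator[OF J(2), of "\<lambda>_. A"]
    by (subst sum.reindex) (auto simp: case_prod_unfold)
  also have "\<dots> = (\<Sum>(a, y)\<in>A \<times> (J \<rightarrow>\<^sub>E A). w t a * ((\<Prod>i\<in>J. w i (y i)) * G y))"
  proof (intro sum.cong refl, clarify)
    fix a y
    have "(\<Prod>i\<in>J. w i ((y(t := a)) i)) = (\<Prod>i\<in>J. w i (y i))"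
      using J(2) by (intro prod.cong refl) auto
    then show "(\<Prod>i\<in>I. w i ((y(t := a)) i)) * G (y(t := a))
      = w t a * ((\<Prod>i\<in>J. w i (y i)) * G y)"
      using J by (simp add: G mult.assoc)
  qed
  also have "\<dots> = (\<Sum>a\<in>A. w t a) * (\<Sum>y\<in>J \<rightarrow>\<^sub>E A. (\<Prod>i\<in>J. w i (y i)) * G y)"
    by (simp add: sum_product sum.cartesian_product)
  finally show ?thesis using assms(3) by simp
qed

text \<open>The mixed difference is summed over the grid against the weights \<open>W\<close>. Only
  its term for \<open>T = {}\<close> survives, and that is the nonzero coefficient of
  \<open>u\<close>; hence some mixed difference is nonzero.\<close>

lemma mixed_difference_nonzero:
  assumes "finite A" "card A > 0" "Poly_Mapping.keys p \<subseteq> exponents n (card A - 1)"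
    and rep: "represents n A p f" and u: "u \<in> Poly_Mapping.keys p" and a: "a \<in> A"
  obtains x where "x \<in> cube n A"
    "(\<Sum>T\<in>Pow (Poly_Mapping.keys u). (-1) ^ card T * f (override_on x (\<lambda>_. a) T)) \<noteq> 0"
proof -
  define K where "K = Poly_Mapping.keys u"
  define W where "W x = (\<Prod>i<n. dual_weight A (Poly_Mapping.lookup u i) (x i))" for x
  have uU: "u \<in> exponents n (card A - 1)" using assms(3) u by blast
  have K: "finite K" "K \<subseteq> {..<n}" using uU by (auto simp: K_def exponents_def)
  \<comment> \<open>Overriding on \<open>T\<close> makes \<open>f\<close> independent of any
    coordinate \<open>t \<in> T\<close>, and the weights at \<open>t\<close> sum to zero because the
    exponent of \<open>u\<close> there is positive.\<close>
  have vanish: "(\<Sum>x\<in>cube n A. W x * f (override_on x (\<lambda>_. a) T)) = 0" if T: "T \<subseteq> K" "T \<noteq> {}" for T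
  proof -
    obtain t where t: "t \<in> T" using T by blast
    then have "t < n" "Poly_Mapping.lookup u t \<noteq> 0" using T K by (auto simp: K_def in_keys_iff)
    moreover have "override_on (x(t := b)) (\<lambda>_. a) T = override_on x (\<lambda>_. a) T" for x b
      using t by (auto simp: override_on_def)
    ultimately show ?thesis
      unfolding W_def cube_def
      using sum_dual_weight_points[OF assms(1,2), of "Poly_Mapping.lookup u t"]
      by (intro sum_PiE_prod_eq_0[of _ t]) auto
  qed
  have "(\<Sum>x\<in>cube n A. W x * (\<Sum>T\<in>Pow K. (-1) ^ card T * f (override_on x (\<lambda>_. a) T)))
    = (\<Sum>T\<in>Pow K. (-1) ^ card T * (\<Sum>x\<in>cube n A. W x * f (override_on x (\<lambda>_. a) T)))"
    unfolding sum_distrib_left by (subst sum.swap) (simp add: mult.left_commute)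
  also have "\<dots> = (\<Sum>T\<in>{{}}. (-1) ^ card T * (\<Sum>x\<in>cube n A. W x * f (override_on x (\<lambda>_. a) T)))"
    using K(1) vanish by (intro sum.mono_neutral_right) auto
  also have "\<dots> = Poly_Mapping.lookup p u"
    using rep by (simp add: lookup_eq_sum_cube[OF assms(1-3) uU] W_def represents_def)
  also have "\<dots> \<noteq> 0" using u by (simp add: in_keys_iff)
  finally obtain x where "x \<in> cube n A"
    "W x * (\<Sum>T\<in>Pow K. (-1) ^ card T * f (override_on x (\<lambda>_. a) T)) \<noteq> 0"
    by (meson sum.neutral)
  then show thesis using that by (auto simp: K_def)
qed

text \<open>The value of \<open>f\<close> forces each \<open>y i\<close> to differ from
  \<open>x\<close>, hence exactly at coordinate \<open>i\<close>. The points \<open>y i\<close> are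
  thus distinct sensitive neighbours of \<open>x\<close>.\<close>

lemma local_sensitivity_ge_card:
  assumes "finite A" "I \<subseteq> {..<n}"
    and y: "\<And>i. i \<in> I \<Longrightarrow> y i \<in> cube n A" "\<And>i. i \<in> I \<Longrightarrow> f (y i) \<noteq> f x"
    and eq: "\<And>i j. i \<in> I \<Longrightarrow> j \<noteq> i \<Longrightarrow> y i j = x j"
  shows "card I \<le> local_sensitivity n A f x"
proof -
  have neq: "y i i \<noteq> x i" if "i \<in> I" for i
  proof
    assume "y i i = x i"
    then have "y i = x" using eq[OF that] by (metis ext)
    with y(2)[OF that] show False by simp
  qed
  have "hamming_dist n x (y i) = 1" if "i \<in> I" for i
  proof -
    have "{j \<in> {..<n}. x j \<noteq> y i j} = {i}"
      using neq eq that assms(2) by fastforce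
    then show ?thesis by (simp add: hamming_dist_def)
  qed
  moreover have "inj_on y I"
    using neq eq by (intro inj_onI) metis
  ultimately show ?thesis
    unfolding local_sensitivity_def using assms(1) y
    by (intro card_inj_on_le[of y]) auto
qed

lemma sqrt_card_keys_le_sensitivity:
  assumes "finite A" "card A > 0" and u: "u \<in> Poly_Mapping.keys (representing_poly n A f)"
  shows "sqrt (card (Poly_Mapping.keys u)) \<le> sensitivity n A f"
proof -
  define K where "K = Poly_Mapping.keys u"
  obtain a where a: "a \<in> A" using assms(2) by fastforce
  note rp = representing_poly[OF assms(1,2), of n f]
  obtain x where x: "x \<in> cube n A"
    "(\<Sum>T\<in>Pow K. (-1) ^ card T * f (override_on x (\<lambda>_. a) T)) \<noteq> 0"
    using mixed_difference_nonzero[OF assms(1,2) rp u a] unfolding K_def by blast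
  have K: "finite K" "K \<subseteq> {..<n}" using u rp(1) by (auto simp: K_def exponents_def)
  \<comment> \<open>The subcube resets the coordinates in \<open>T\<close> to the base value
    \<open>a\<close>. Flipping a direction \<open>i\<close> with \<open>x i = a\<close> would not
    move the point, so such a direction cannot be counted as sensitive.\<close>
  define z where "z T = override_on x (\<lambda>_. a) T" for T
  obtain T where T: "T \<subseteq> K" "sqrt (card K) \<le> card {i \<in> K. f (z (flip i T)) \<noteq> f (z T)}"
    using sensitive_vertex_of_boolean_cube[of K "\<lambda>T. f (z T)"] K(1) x(2) unfolding z_def by blast
  have z_cube: "z T' \<in> cube n A" if "T' \<subseteq> K" for T'
    using that x(1) a K(2) by (auto simp: z_def cube_def override_on_def PiE_def extensional_def)
  have "card {i \<in> K. f (z (flip i T)) \<noteq> f (z T)} \<le> local_sensitivity n A f (z T)"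
    using assms(1) K T(1)
    by (intro local_sensitivity_ge_card[of _ _ _ "\<lambda>i. z (flip i T)"] z_cube)
      (auto simp: z_def override_on_def mem_flip_iff)
  also have "\<dots> \<le> sensitivity n A f"
    unfolding sensitivity_def using assms(1) z_cube[OF T(1)] by (intro Max_ge) auto
  finally show ?thesis using T(2) by (simp add: K_def)
qed

text \<open>The maximum is attained at the inserted default \<open>0\<close> or at a monomial; the
  default covers the zero polynomial.\<close>

lemma total_degree_cases:
  obtains "total_degree p = 0"
  | u where "u \<in> Poly_Mapping.keys p"
    "total_degree p = (\<Sum>i\<in>Poly_Mapping.keys u. Poly_Mapping.lookup u i)"
proof -
  have "total_degree p \<in> insert 0 ((\<lambda>u. \<Sum>i\<in>Poly_Mapping.keys u. Poly_Mapping.lookup u i) ` Poly_Mapping.keys p)"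
    unfolding total_degree_def by (intro Max_in) auto
  with that show thesis by auto
qed

theorem theorem1p2:
  fixes n :: nat and A B :: "real set" and f :: "(nat \<Rightarrow> real) \<Rightarrow> real"
  assumes "n \<ge> 1"
    and "finite A" and "finite B" and "card A \<ge> 2"
    and "f \<in> cube n A \<rightarrow> B"
  shows "real (sensitivity n A f) \<ge> sqrt (real (fun_degree n A f) / (real (card A) - 1))"
proof -
  define p where "p = representing_poly n A f"
  have A: "card A > 0" using assms(4) by simp
  show ?thesis
  proof (cases p rule: total_degree_cases)
    case 1
    then show ?thesis by (simp add: fun_degree_def p_def)
  next
    case (2 u)
    then have u: "u \<in> Poly_Mapping.keys (representing_poly n A f)" by (simp add: p_def)
    then have "u \<in> exponents n (card A - 1)"
      using representing_poly(1)[OF assms(2) A] by blast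
    then have "total_degree p \<le> card (Poly_Mapping.keys u) * (card A - 1)"
      unfolding 2(2) using sum_bounded_above[of "Poly_Mapping.keys u" "Poly_Mapping.lookup u" "card A - 1"]
      by (simp add: exponents_def)
    then have "real (total_degree p) \<le> real (card (Poly_Mapping.keys u) * (card A - 1))"
      by (simp only: of_nat_le_iff)
    \<comment> \<open>The divisor is positive because \<open>card A \<ge> 2\<close>.\<close>
    then have "real (total_degree p) / (real (card A) - 1) \<le> card (Poly_Mapping.keys u)"
      using assms(4) by (simp add: divide_le_eq of_nat_diff)
    then have "sqrt (real (fun_degree n A f) / (real (card A) - 1))
      \<le> sqrt (card (Poly_Mapping.keys u))"
      by (simp add: fun_degree_def p_def)
    also have "\<dots> \<le> sensitivity n A f"
      using sqrt_card_keys_le_sensitivity[OF assms(2) A u] .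
    finally show ?thesis .
  qed
qed

end
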